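(* Let $X$ be a separable complex Banach space and let $T\in\mathcal{B}(X)$ be a quasinilpotent operator such that $\sigma_p(T)=\sigma_p(T^* )=\emptyset$. Then for any rank one operator $F\in\mathcal{B}(X)$, and for all non-zero $\alpha\in\mathbb{C}$ with at most two exceptions (which may depend on $F$), the operator $T+\alpha F$ has an invariant half-space.
   Context: $\mathcal{B}(X)$ denotes the algebra of bounded linear operators on $X$. An operator $T$ is quasinilpotent if its spectrum is $\sigma(T)=\{0\}$. $\sigma_p(T)$ denotes the point spectrum (set of eigenvalues) of $T$, and $T^*$ denotes the adjoint operator on the dual space $X^*$. A half-space of $X$ is a closed linear subspace $Y\subseteq X$ which is both infinite dimensional and of infinite codimension in $X$; it is invariant for an operator $S$ if $S(Y)\subseteq Y$. A rank one operator is a bounded linear operator whose range has dimension exactly one. *)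

theory Defs
  imports "HOL-Analysis.Analysis"
begin

section \<open>Complex Banach spaces\<close>

class scaleC = scaleR +
  fixes scaleC :: "complex \<Rightarrow> 'a \<Rightarrow> 'a"  (infixr \<open>*\<^sub>C\<close> 75)

class complex_vector = real_vector + scaleC +
  assumes scaleC_add_right: "a *\<^sub>C (x + y) = a *\<^sub>C x + a *\<^sub>C y"
    and scaleC_add_left: "(a + b) *\<^sub>C x = a *\<^sub>C x + b *\<^sub>C x"
    and scaleC_scaleC: "a *\<^sub>C b *\<^sub>C x = (a * b) *\<^sub>C x"
    and scaleR_scaleC: "r *\<^sub>R x = complex_of_real r *\<^sub>C x"
begin

lemma scaleC_one: "1 *\<^sub>C x = x"
  using scaleR_scaleC[of 1 x] scaleR_one[of x] by simp

end

class complex_normed_vector = complex_vector + real_normed_vector +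
  assumes norm_scaleC: "norm (a *\<^sub>C x) = cmod a * norm x"

class complex_banach = complex_normed_vector + banach

global_interpretation complex_vector:
  vector_space "scaleC :: complex \<Rightarrow> 'a \<Rightarrow> 'a :: complex_vector"
  defines cdependent = complex_vector.dependent
    and crepresentation = complex_vector.representation
    and csubspace = complex_vector.subspace
    and cspan = complex_vector.span
    and cextend_basis = complex_vector.extend_basis
    and cdim = complex_vector.dim
  by unfold_locales
    (simp_all add: scaleC_add_right scaleC_add_left scaleC_scaleC scaleC_one)

instantiation complex :: complex_banach
begin

definition scaleC_complex :: "complex \<Rightarrow> complex \<Rightarrow> complex"
  where "scaleC_complex = (*)"

instance
  by standard
    (simp_all add: scaleC_complex_def algebra_simps norm_mult scaleR_conv_of_real)

end


section \<open>Bounded complex-linear operators\<close>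

locale bounded_clinear = bounded_linear f
  for f :: "'a::complex_normed_vector \<Rightarrow> 'b::complex_normed_vector" +
  assumes scaleC: "f (c *\<^sub>C x) = c *\<^sub>C f x"

lemma bounded_clinearI:
  assumes "bounded_linear f" "\<And>c x. f (c *\<^sub>C x) = c *\<^sub>C f x"
  shows "bounded_clinear f"
  using assms by (simp add: bounded_clinear_def bounded_clinear_axioms_def)

lemma bounded_clinearD:
  assumes "bounded_clinear f"
  shows "bounded_linear f" "f (c *\<^sub>C x) = c *\<^sub>C f x"
  using assms by (simp_all add: bounded_clinear_def bounded_clinear_axioms_def)

lemma bounded_linear_scaleC_right:
  "bounded_linear (\<lambda>x::'a::complex_normed_vector. c *\<^sub>C x)"
  by (rule bounded_linear_intro[where K = "cmod c"])
    (simp_all add: scaleC_add_right scaleR_scaleC scaleC_scaleC norm_scaleC mult.commute)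

lemma scaleC_zero: "c *\<^sub>C (0::'a::complex_vector) = 0"
  using scaleC_add_right[of c 0 "0::'a"] by simp

lemma scaleC_minus: "c *\<^sub>C (- x) = - (c *\<^sub>C (x::'a::complex_vector))"
  using scaleC_add_right[of c x "- x"] by (simp add: scaleC_zero minus_unique)

typedef (overloaded) ('a, 'b) cblinfun (\<open>(_ \<Rightarrow>\<^sub>C\<^sub>L /_)\<close> [22, 21] 21) =
  "{f :: 'a::complex_normed_vector \<Rightarrow> 'b::complex_normed_vector. bounded_clinear f}"
  morphisms cblinfun_apply CBlinfun
  by (auto intro!: exI[of _ "\<lambda>_. 0"] bounded_clinearI simp: scaleC_zero)

declare [[coercion "cblinfun_apply :: ('a::complex_normed_vector \<Rightarrow>\<^sub>C\<^sub>L 'b::complex_normed_vector) \<Rightarrow> 'a \<Rightarrow> 'b"]]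

setup_lifting type_definition_cblinfun

instantiation cblinfun :: (complex_normed_vector, complex_normed_vector) complex_normed_vector
begin

lift_definition norm_cblinfun :: "('a \<Rightarrow>\<^sub>C\<^sub>L 'b) \<Rightarrow> real" is onorm .

lift_definition zero_cblinfun :: "'a \<Rightarrow>\<^sub>C\<^sub>L 'b" is "\<lambda>x. 0"
  by (auto intro!: bounded_clinearI simp: scaleC_zero)

lift_definition plus_cblinfun :: "('a \<Rightarrow>\<^sub>C\<^sub>L 'b) \<Rightarrow> ('a \<Rightarrow>\<^sub>C\<^sub>L 'b) \<Rightarrow> 'a \<Rightarrow>\<^sub>C\<^sub>L 'b"
  is "\<lambda>f g x. f x + g x"
  by (auto intro!: bounded_clinearI bounded_linear_add
      simp: bounded_clinearD scaleC_add_right)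

lift_definition uminus_cblinfun :: "('a \<Rightarrow>\<^sub>C\<^sub>L 'b) \<Rightarrow> 'a \<Rightarrow>\<^sub>C\<^sub>L 'b" is "\<lambda>f x. - f x"
  by (auto intro!: bounded_clinearI bounded_linear_minus
      simp: bounded_clinearD scaleC_minus)

definition minus_cblinfun :: "('a \<Rightarrow>\<^sub>C\<^sub>L 'b) \<Rightarrow> ('a \<Rightarrow>\<^sub>C\<^sub>L 'b) \<Rightarrow> 'a \<Rightarrow>\<^sub>C\<^sub>L 'b"
  where "minus_cblinfun f g = f + - g"

lift_definition scaleR_cblinfun :: "real \<Rightarrow> ('a \<Rightarrow>\<^sub>C\<^sub>L 'b) \<Rightarrow> 'a \<Rightarrow>\<^sub>C\<^sub>L 'b"
  is "\<lambda>r f x. r *\<^sub>R f x"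
  by (auto simp: scaleR_scaleC bounded_clinearD scaleC_scaleC mult.commute
      intro!: bounded_clinearI bounded_linear_compose[OF bounded_linear_scaleC_right])

lift_definition scaleC_cblinfun :: "complex \<Rightarrow> ('a \<Rightarrow>\<^sub>C\<^sub>L 'b) \<Rightarrow> 'a \<Rightarrow>\<^sub>C\<^sub>L 'b"
  is "\<lambda>c f x. c *\<^sub>C f x"
  by (auto intro!: bounded_clinearI bounded_linear_compose[OF bounded_linear_scaleC_right]
      simp: bounded_clinearD scaleC_scaleC mult.commute)


definition sgn_cblinfun :: "('a \<Rightarrow>\<^sub>C\<^sub>L 'b) \<Rightarrow> 'a \<Rightarrow>\<^sub>C\<^sub>L 'b"
  where "sgn_cblinfun f = scaleR (inverse (norm f)) f"

definition dist_cblinfun :: "('a \<Rightarrow>\<^sub>C\<^sub>L 'b) \<Rightarrow> ('a \<Rightarrow>\<^sub>C\<^sub>L 'b) \<Rightarrow> real"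
  where "dist_cblinfun f g = norm (f - g)"

definition [code del]:
  "(uniformity :: (('a \<Rightarrow>\<^sub>C\<^sub>L 'b) \<times> ('a \<Rightarrow>\<^sub>C\<^sub>L 'b)) filter) =
     (INF e\<in>{0 <..}. principal {(f, g). dist f g < e})"

definition open_cblinfun :: "('a \<Rightarrow>\<^sub>C\<^sub>L 'b) set \<Rightarrow> bool"
  where [code del]:
    "open_cblinfun S = (\<forall>f\<in>S. \<forall>\<^sub>F (f', g) in uniformity. f' = f \<longrightarrow> g \<in> S)"

lemma norm_scaleC_cblinfun_le: "norm (c *\<^sub>C f) \<le> cmod c * norm f" for f :: "'a \<Rightarrow>\<^sub>C\<^sub>L 'b"
proof transfer
  fix c and f :: "'a \<Rightarrow> 'b"
  assume "bounded_clinear f"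
  then have f: "bounded_linear f" by (rule bounded_clinearD)
  show "onorm (\<lambda>x. c *\<^sub>C f x) \<le> cmod c * onorm f"
    by (rule onorm_bound)
      (use onorm[OF f] onorm_pos_le[OF f] in
        \<open>auto simp: norm_scaleC mult.assoc intro!: mult_left_mono\<close>)
qed

instance
proof
  fix f g h :: "'a \<Rightarrow>\<^sub>C\<^sub>L 'b" and a b :: complex and r s :: real
  show "f + g + h = f + (g + h)" by transfer (simp add: add.assoc)
  show "f + g = g + f" by transfer (simp add: add.commute)
  show "0 + f = f" by transfer simp
  show "- f + f = 0" by transfer simp
  show "f - g = f + - g" by (simp add: minus_cblinfun_def)
  show C: "a *\<^sub>C (f + g) = a *\<^sub>C f + a *\<^sub>C g" for a f and g :: "'a \<Rightarrow>\<^sub>C\<^sub>L 'b"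
    by transfer (simp add: scaleC_add_right)
  show D: "(a + b) *\<^sub>C f = a *\<^sub>C f + b *\<^sub>C f" for a b and f :: "'a \<Rightarrow>\<^sub>C\<^sub>L 'b"
    by transfer (simp add: scaleC_add_left)
  show E: "a *\<^sub>C b *\<^sub>C f = (a * b) *\<^sub>C f" for a b and f :: "'a \<Rightarrow>\<^sub>C\<^sub>L 'b"
    by transfer (simp add: scaleC_scaleC)
  show RC: "r *\<^sub>R f = complex_of_real r *\<^sub>C f" for r and f :: "'a \<Rightarrow>\<^sub>C\<^sub>L 'b"
    by transfer (simp add: scaleR_scaleC)
  show "r *\<^sub>R (f + g) = r *\<^sub>R f + r *\<^sub>R g" by (simp add: RC C)
  show "(r + s) *\<^sub>R f = r *\<^sub>R f + s *\<^sub>R f" by (simp add: RC D)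
  show "r *\<^sub>R s *\<^sub>R f = (r * s) *\<^sub>R f" by (simp add: RC E)
  have one: "1 *\<^sub>C f = f" for f :: "'a \<Rightarrow>\<^sub>C\<^sub>L 'b" by transfer (simp add: scaleC_one)
  show "1 *\<^sub>R f = f" by (simp add: RC one)
  show "sgn f = scaleR (inverse (norm f)) f" by (simp add: sgn_cblinfun_def)
  show "dist f g = norm (f - g)" by (simp add: dist_cblinfun_def)
  show "(uniformity :: (('a \<Rightarrow>\<^sub>C\<^sub>L 'b) \<times> ('a \<Rightarrow>\<^sub>C\<^sub>L 'b)) filter) =
     (INF e\<in>{0 <..}. principal {(f, g). dist f g < e})"
    by (rule uniformity_cblinfun_def)
  show "open S = (\<forall>f\<in>S. \<forall>\<^sub>F (f', g) in uniformity. f' = f \<longrightarrow> g \<in> S)"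
    for S :: "('a \<Rightarrow>\<^sub>C\<^sub>L 'b) set"
    by (rule open_cblinfun_def)
  show "norm f = 0 \<longleftrightarrow> f = 0"
    by transfer (use onorm_eq_0 bounded_clinearD(1) in \<open>auto simp: fun_eq_iff\<close>)
  show "norm (f + g) \<le> norm f + norm g"
    by transfer (simp add: onorm_triangle bounded_clinearD(1))
  have zero: "norm (0 :: 'a \<Rightarrow>\<^sub>C\<^sub>L 'b) = 0" by transfer (rule onorm_zero)
  show N: "norm (a *\<^sub>C f) = cmod a * norm f" for a and f :: "'a \<Rightarrow>\<^sub>C\<^sub>L 'b"
  proof (cases "a = 0")
    case True
    have "0 *\<^sub>C f = 0" using D[of 0 0 f] by (transfer, simp add: fun_eq_iff)
    then show ?thesis using True zero by simp
  next
    case False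
    have "norm f = norm (inverse a *\<^sub>C a *\<^sub>C f)" using False by (simp add: E one)
    also have "\<dots> \<le> norm (a *\<^sub>C f) / cmod a"
      using norm_scaleC_cblinfun_le[of "inverse a" "a *\<^sub>C f"]
      by (simp add: norm_inverse divide_inverse mult.commute)
    finally have "cmod a * norm f \<le> norm (a *\<^sub>C f)"
      using False by (simp add: field_simps)
    then show ?thesis using norm_scaleC_cblinfun_le[of a f] by simp
  qed
  show "norm (r *\<^sub>R f) = \<bar>r\<bar> * norm f" by (simp add: RC N)
qed

end

lift_definition id_cblinfun :: "'a::complex_normed_vector \<Rightarrow>\<^sub>C\<^sub>L 'a" is "\<lambda>x. x"
  by (auto intro!: bounded_clinearI)

lift_definition cblinfun_compose ::
    "('b::complex_normed_vector \<Rightarrow>\<^sub>C\<^sub>L 'c::complex_normed_vector) \<Rightarrow>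
     ('a::complex_normed_vector \<Rightarrow>\<^sub>C\<^sub>L 'b) \<Rightarrow> 'a \<Rightarrow>\<^sub>C\<^sub>L 'c"  (infixl \<open>o\<^sub>C\<^sub>L\<close> 67)
  is "\<lambda>f g x. f (g x)"
  by (auto intro!: bounded_clinearI intro: bounded_linear_compose simp: bounded_clinearD)

lemma norm_cblinfun_compose_le: "norm (f o\<^sub>C\<^sub>L g) \<le> norm f * norm g"
  by transfer (blast intro: onorm_compose[unfolded o_def] bounded_clinearD(1))

text \<open>
  The Banach space adjoint \<open>T\<^sup>* f = f \<circ> T\<close> on the dual space of bounded complex-linear
  functionals; it is complex-linear (not conjugate-linear) in \<open>T\<close>.
\<close>

lift_definition cadjoint ::
    "('a::complex_normed_vector \<Rightarrow>\<^sub>C\<^sub>L 'b::complex_normed_vector) \<Rightarrow>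
     ('b \<Rightarrow>\<^sub>C\<^sub>L complex) \<Rightarrow>\<^sub>C\<^sub>L ('a \<Rightarrow>\<^sub>C\<^sub>L complex)"
  is "\<lambda>T f. f o\<^sub>C\<^sub>L T"
proof -
  fix T :: "'a \<Rightarrow>\<^sub>C\<^sub>L 'b"
  have add: "(f + g) o\<^sub>C\<^sub>L T = f o\<^sub>C\<^sub>L T + g o\<^sub>C\<^sub>L T" for f g :: "'b \<Rightarrow>\<^sub>C\<^sub>L complex"
    by transfer simp
  have scale: "(c *\<^sub>C f) o\<^sub>C\<^sub>L T = c *\<^sub>C (f o\<^sub>C\<^sub>L T)" for c and f :: "'b \<Rightarrow>\<^sub>C\<^sub>L complex"
    by transfer simp
  show "bounded_clinear (\<lambda>f :: 'b \<Rightarrow>\<^sub>C\<^sub>L complex. f o\<^sub>C\<^sub>L T)"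
    by (intro bounded_clinearI bounded_linear_intro[where K = "norm T"])
      (simp_all add: add scale scaleR_scaleC norm_cblinfun_compose_le)
qed


section \<open>Spectra\<close>

definition spectrum :: "('a::complex_normed_vector \<Rightarrow>\<^sub>C\<^sub>L 'a) \<Rightarrow> complex set"
  where "spectrum T = {c. \<not> (\<exists>S. S o\<^sub>C\<^sub>L (T - c *\<^sub>C id_cblinfun) = id_cblinfun \<and>
                                (T - c *\<^sub>C id_cblinfun) o\<^sub>C\<^sub>L S = id_cblinfun)}"

definition point_spectrum :: "('a::complex_normed_vector \<Rightarrow>\<^sub>C\<^sub>L 'a) \<Rightarrow> complex set"
  where "point_spectrum T = {c. \<exists>x. x \<noteq> 0 \<and> T x = c *\<^sub>C x}"

definition quasinilpotent :: "('a::complex_normed_vector \<Rightarrow>\<^sub>C\<^sub>L 'a) \<Rightarrow> bool"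
  where "quasinilpotent T \<longleftrightarrow> spectrum T = {0}"


section \<open>Half-spaces and rank one operators\<close>

definition cfinite_dim :: "'a::complex_vector set \<Rightarrow> bool"
  where "cfinite_dim Y \<longleftrightarrow> (\<exists>B. finite B \<and> Y = cspan B)"

text \<open>
  The second conjunct says that the cosets of the elements of \<open>B\<close> span the quotient of the
  whole space by \<open>Y\<close>, i.e. that this quotient is finite dimensional.
\<close>

definition cfinite_codim :: "'a::complex_vector set \<Rightarrow> bool"
  where "cfinite_codim Y \<longleftrightarrow> (\<exists>B. finite B \<and> (\<forall>x. \<exists>b\<in>cspan B. x - b \<in> Y))"

definition half_space :: "'a::complex_normed_vector set \<Rightarrow> bool"
  where "half_space Y \<longleftrightarrow> closed Y \<and> csubspace Y \<and> \<not> cfinite_dim Y \<and> \<not> cfinite_codim Y"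

definition has_invariant_half_space :: "('a::complex_normed_vector \<Rightarrow>\<^sub>C\<^sub>L 'a) \<Rightarrow> bool"
  where "has_invariant_half_space S \<longleftrightarrow> (\<exists>Y. half_space Y \<and> S ` Y \<subseteq> Y)"

text \<open>Since \<open>cdim\<close> is \<open>0\<close> on infinite dimensional spaces, dimension \<open>1\<close> is meant literally here.\<close>

definition rank_one :: "('a::complex_normed_vector \<Rightarrow>\<^sub>C\<^sub>L 'b::complex_normed_vector) \<Rightarrow> bool"
  where "rank_one F \<longleftrightarrow> cdim (range F) = 1"

end

theory Submission
  imports Defs "HOL-Complex_Analysis.Complex_Analysis"
    "HOL-Computational_Algebra.Fundamental_Theorem_Algebra"
begin

text \<open>
  Write \<open>F x = \<phi>(x) e\<close> and \<open>R(z) = (1 - z T)\<inverse>\<close>. Quasinilpotence makes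
  \<open>h(z) = z \<phi>(R(z) e)\<close> an entire function, with Taylor coefficients the moments \<open>\<phi>(T\<^sup>n e)\<close>.

  If \<open>h\<close> is transcendental, then by Picard's great theorem \<open>h(z) = 1/\<alpha>\<close> has infinitely many
  solutions \<open>z\<close> for all \<open>\<alpha>\<close> except at most one, and for each of them \<open>1/z\<close> is an eigenvalue of
  \<open>T + \<alpha> F\<close> with eigenvector \<open>R(z) e\<close>, and of its adjoint with eigenvector \<open>\<phi> \<circ> R(z)\<close>. Split the
  solutions into two infinite halves: the eigenvectors of one half span, up to closure, an
  invariant subspace, which is annihilated by the eigenfunctionals of the other half and hence has
  infinite codimension.

  If \<open>h\<close> is a polynomial, then \<open>\<phi>(T\<^sup>n e) = 0\<close> for all \<open>n \<ge> N\<close>, and the closed span of these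
  \<open>T\<^sup>n e\<close> is a \<open>T\<close>-invariant subspace on which \<open>F\<close> vanishes. It is a half-space, since a non-zero
  finite dimensional invariant subspace, of \<open>T\<close> or of \<open>T\<^sup>*\<close>, would contain an eigenvector.
\<close>

section \<open>Complex linear algebra\<close>

lemma cblinfun_apply_bounded_clinear: "bounded_clinear (cblinfun_apply S)"
  using cblinfun_apply[of S] by simp

lemma cblinfun_apply_bounded_linear: "bounded_linear (cblinfun_apply S)"
  by (rule bounded_clinearD(1)[OF cblinfun_apply_bounded_clinear])

lemma cblinfun_apply_add [simp]: "cblinfun_apply S (x + y) = S x + S y"
  by (rule linear_add[OF bounded_linear.linear[OF cblinfun_apply_bounded_linear]])

lemma cblinfun_apply_diff [simp]: "cblinfun_apply S (x - y) = S x - S y"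
  by (rule linear_diff[OF bounded_linear.linear[OF cblinfun_apply_bounded_linear]])

lemma cblinfun_apply_0 [simp]: "cblinfun_apply S 0 = 0"
  by (rule linear_0[OF bounded_linear.linear[OF cblinfun_apply_bounded_linear]])

lemma cblinfun_apply_scaleC [simp]: "cblinfun_apply S (c *\<^sub>C x) = c *\<^sub>C S x"
  by (rule bounded_clinearD(2)[OF cblinfun_apply_bounded_clinear])

lemma plus_cblinfun_apply [simp]: "cblinfun_apply (S + R) x = S x + R x"
  by transfer simp

lemma zero_cblinfun_apply [simp]: "cblinfun_apply 0 x = 0"
  by transfer simp

lemma minus_cblinfun_apply [simp]: "cblinfun_apply (S - R) x = S x - R x"
  unfolding minus_cblinfun_def by transfer simp

lemma scaleC_cblinfun_apply [simp]: "cblinfun_apply (c *\<^sub>C S) x = c *\<^sub>C S x"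
  by transfer simp

lemma id_cblinfun_apply [simp]: "cblinfun_apply id_cblinfun x = x"
  by transfer simp

lemma cblinfun_compose_apply [simp]: "cblinfun_apply (S o\<^sub>C\<^sub>L R) x = S (R x)"
  by transfer simp

lemma cadjoint_apply [simp]: "cblinfun_apply (cadjoint S) g = g o\<^sub>C\<^sub>L S"
  by transfer simp

lemma cblinfun_apply_minus [simp]: "cblinfun_apply S (- x) = - S x"
  by (rule linear_neg[OF bounded_linear.linear[OF cblinfun_apply_bounded_linear]])

lemma uminus_cblinfun_apply [simp]: "cblinfun_apply (- S) x = - S x"
  by transfer simp

lemma cblinfun_eqI: "(\<And>x. cblinfun_apply S x = cblinfun_apply R x) \<Longrightarrow> S = R"
  by (simp add: cblinfun_apply_inject[symmetric] fun_eq_iff)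

lemma norm_cblinfun_apply_le: "norm (cblinfun_apply S x) \<le> norm S * norm x"
  unfolding norm_cblinfun.rep_eq by (rule onorm[OF cblinfun_apply_bounded_linear])

lemma continuous_on_cblinfun_apply: "continuous_on X (cblinfun_apply S)"
  by (rule linear_continuous_on[OF cblinfun_apply_bounded_linear])

section \<open>Subspaces, closures and spans\<close>

lemma csubspace_cblinfun_vimage:
  assumes "csubspace V"
  shows "csubspace {x. cblinfun_apply S x \<in> V}"
  using assms by (auto simp: complex_vector.subspace_def)

lemma csubspace_closure:
  fixes V :: "'a::complex_normed_vector set"
  assumes V: "csubspace V"
  shows "csubspace (closure V)"
proof (rule complex_vector.subspaceI)
  show "0 \<in> closure V"
    using complex_vector.subspace_0[OF V] closure_subset by blast
next
  fix x y assume "x \<in> closure V" "y \<in> closure V"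
  then obtain a b where ab: "\<forall>n. a n \<in> V" "a \<longlonglongrightarrow> x" "\<forall>n. b n \<in> V" "b \<longlonglongrightarrow> y"
    unfolding closure_sequential by blast
  show "x + y \<in> closure V"
    unfolding closure_sequential
  proof (intro exI conjI allI)
    show "a n + b n \<in> V" for n using ab by (simp add: complex_vector.subspace_add[OF V])
    show "(\<lambda>n. a n + b n) \<longlonglongrightarrow> x + y" using ab(2,4) by (rule tendsto_add)
  qed
next
  fix c and x assume "x \<in> closure V"
  moreover have "(\<lambda>x. c *\<^sub>C x) ` closure V \<subseteq> closure V"
  proof (rule image_closure_subset)
    show "continuous_on (closure V) (\<lambda>x. c *\<^sub>C x)"
      by (rule linear_continuous_on[OF bounded_linear_scaleC_right])
    show "(\<lambda>x. c *\<^sub>C x) ` V \<subseteq> closure V"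
      using closure_subset[of V] complex_vector.subspace_scale[OF V] by blast
  qed simp
  ultimately show "c *\<^sub>C x \<in> closure V" by blast
qed

text \<open>The preimage of \<open>closure (cspan C)\<close> is a subspace, so with \<open>A\<close>
  it contains the span of \<open>A\<close>; continuity extends this to the closure. Taking
  \<open>C = A\<close> gives invariance, \<open>C = {}\<close> gives vanishing.\<close>

lemma cblinfun_closure_cspan_subset:
  assumes "cblinfun_apply S ` A \<subseteq> closure (cspan C)"
  shows "cblinfun_apply S ` closure (cspan A) \<subseteq> closure (cspan C)"
proof (rule image_closure_subset[OF continuous_on_cblinfun_apply closed_closure])
  have "cspan A \<subseteq> {x. cblinfun_apply S x \<in> closure (cspan C)}"
    using assms
    by (intro complex_vector.span_minimal csubspace_cblinfun_vimage csubspace_closure) auto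
  then show "cblinfun_apply S ` cspan A \<subseteq> closure (cspan C)" by auto
qed

lemma cblinfun_vanishes_on_closure_cspan:
  fixes f :: "'a::complex_normed_vector \<Rightarrow>\<^sub>C\<^sub>L 'b::complex_normed_vector"
  assumes "\<And>x. x \<in> A \<Longrightarrow> f x = 0" "y \<in> closure (cspan A)"
  shows "f y = 0"
proof -
  have "f ` closure (cspan A) \<subseteq> closure (cspan {})"
    by (rule cblinfun_closure_cspan_subset) (use assms(1) in auto)
  then show ?thesis using assms(2) by auto
qed

section \<open>Linear independence of eigenvectors\<close>

text \<open>Otherwise every initial segment of \<open>v\<close> would consist of distinct
  independent vectors, and the one with \<open>card B + 1\<close> members would be too large for
  \<open>cspan B\<close>.\<close>

lemma in_span_of_previous:
  fixes v :: "nat \<Rightarrow> 'a::complex_vector"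
  assumes "finite B" "range v \<subseteq> cspan B"
  shows "\<exists>n. v n \<in> cspan (v ` {..<n})"
proof (rule ccontr)
  assume "\<not> ?thesis"
  then have nin: "v n \<notin> cspan (v ` {..<n})" for n by blast
  have indep: "\<not> cdependent (v ` {..<n})" and card: "card (v ` {..<n}) = n" for n
  proof (induction n)
    case 0
    show "\<not> cdependent (v ` {..<0})" "card (v ` {..<0}) = 0"
      by (simp_all add: complex_vector.independent_empty)
  next
    case (Suc n)
    have eq: "v ` {..<Suc n} = insert (v n) (v ` {..<n})"
      by (simp add: lessThan_Suc)
    show "\<not> cdependent (v ` {..<Suc n})"
      unfolding eq by (rule complex_vector.independent_insertI[OF nin Suc(1)])
    have "v n \<notin> v ` {..<n}"
      using nin[of n] complex_vector.span_superset[of "v ` {..<n}"] by (rule contra_subsetD[rotated])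
    from card_insert_disjoint[OF finite_imageI[OF finite_lessThan] this]
    show "card (v ` {..<Suc n}) = Suc n"
      unfolding eq Suc(2) .
  qed
  have "v ` {..<Suc (card B)} \<subseteq> cspan B" using assms(2) by fast
  then have "card (v ` {..<Suc (card B)}) \<le> card B"
    by (rule conjunct2[OF complex_vector.independent_span_bound[OF assms(1) indep]])
  then show False unfolding card by simp
qed

text \<open>Applying \<open>S - \<mu> m\<close> removes \<open>v m\<close> from a combination but
  only rescales an eigenvector for another eigenvalue, so the span can be shrunk step by step to
  zero.\<close>

lemma eigenvector_not_in_span_of_others:
  fixes S :: "'a::complex_normed_vector \<Rightarrow>\<^sub>C\<^sub>L 'a"
  assumes v: "\<And>i. v i \<noteq> 0" "\<And>i. S (v i) = \<mu> i *\<^sub>C v i" and inj: "inj \<mu>"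
  shows "v n \<notin> cspan (v ` {..<n::nat})"
proof -
  \<comment> \<open>Used at the end with \<open>x = v n\<close>, \<open>c = \<mu> n\<close> and
    \<open>m = n\<close>; keeping \<open>m\<close> separate lets the induction run with the
    eigenvalue \<open>c\<close> fixed.\<close>
  have "x = 0" if "x \<in> cspan (v ` {..<m})" "S x = c *\<^sub>C x" "\<And>i. i < m \<Longrightarrow> \<mu> i \<noteq> c" for x c m
    using that
  proof (induction m)
    case 0
    then show ?case by simp
  next
    case (Suc m)
    from Suc.prems(1) obtain k where k: "x - k *\<^sub>C v m \<in> cspan (v ` {..<m})"
      unfolding lessThan_Suc image_insert complex_vector.span_insert by blast
    define D where "D = S - \<mu> m *\<^sub>C id_cblinfun"
    have "D (v i) \<in> cspan (v ` {..<m})" if "i < m" for i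
    proof -
      have "D (v i) = (\<mu> i - \<mu> m) *\<^sub>C v i"
        unfolding D_def by (simp add: v(2) complex_vector.scale_left_diff_distrib)
      then show ?thesis
        using that by (simp add: complex_vector.span_scale complex_vector.span_base)
    qed
    then have "cspan (v ` {..<m}) \<subseteq> {y. D y \<in> cspan (v ` {..<m})}"
      by (intro complex_vector.span_minimal csubspace_cblinfun_vimage) auto
    with k have "D (x - k *\<^sub>C v m) \<in> cspan (v ` {..<m})" by blast
    also have "D (x - k *\<^sub>C v m) = D x - k *\<^sub>C D (v m)" by simp
    also have "D (v m) = 0" unfolding D_def by (simp add: v(2))
    also have "D x - k *\<^sub>C 0 = (c - \<mu> m) *\<^sub>C x"
      unfolding D_def by (simp add: Suc.prems(2) scaleC_zero complex_vector.scale_left_diff_distrib)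
    finally have "inverse (c - \<mu> m) *\<^sub>C (c - \<mu> m) *\<^sub>C x \<in> cspan (v ` {..<m})"
      by (rule complex_vector.span_scale)
    then have "x \<in> cspan (v ` {..<m})"
      using Suc.prems(3)[of m] unfolding scaleC_scaleC by (simp add: scaleC_one)
    then show ?case by (rule Suc.IH) (use Suc.prems in auto)
  qed
  moreover have "\<mu> i \<noteq> \<mu> n" if "i < n" for i
    using inj that by (metis injD nat_neq_iff)
  ultimately show ?thesis
    using v by blast
qed

corollary eigenvectors_not_in_finite_span:
  fixes S :: "'a::complex_normed_vector \<Rightarrow>\<^sub>C\<^sub>L 'a" and v :: "nat \<Rightarrow> 'a"
  assumes "\<And>i. v i \<noteq> 0" "\<And>i. S (v i) = \<mu> i *\<^sub>C v i" "inj \<mu>" "finite B"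
  shows "\<not> range v \<subseteq> cspan B"
  using in_span_of_previous[OF assms(4), of v]
    eigenvector_not_in_span_of_others[of v S \<mu>, OF assms(1-3)] by blast

section \<open>Polynomials in an operator\<close>

text \<open>This is the vector \<open>p(S) x\<close>, evaluated by Horner's scheme.\<close>

definition poly_act :: "('a::complex_normed_vector \<Rightarrow>\<^sub>C\<^sub>L 'a) \<Rightarrow> complex poly \<Rightarrow> 'a \<Rightarrow> 'a"
  where "poly_act S p x = fold_coeffs (\<lambda>a y. a *\<^sub>C x + S y) p 0"

lemma poly_act_0 [simp]: "poly_act S 0 x = 0"
  by (simp add: poly_act_def)

lemma poly_act_pCons [simp]: "poly_act S (pCons a p) x = a *\<^sub>C x + cblinfun_apply S (poly_act S p x)"
  by (cases "pCons a p = 0") (auto simp: poly_act_def fold_coeffs_pCons_eq)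

lemma poly_act_add: "poly_act S (p + q) x = poly_act S p x + poly_act S q x"
  by (induction p q rule: poly_induct2) (simp_all add: scaleC_add_left algebra_simps)

lemma poly_act_smult: "poly_act S (smult c p) x = c *\<^sub>C poly_act S p x"
  by (induction p) (simp_all add: scaleC_add_right scaleC_scaleC)

lemma poly_act_monom: "poly_act S (monom 1 n) x = (cblinfun_apply S ^^ n) x"
  by (induction n) (simp_all add: monom_Suc monom_0 scaleC_one)

text \<open>The orbit of \<open>x\<close> stays in a finite dimensional span, so some iterate
  depends linearly on the earlier ones, and this relation is a polynomial.\<close>

lemma exists_annihilating_poly:
  fixes S :: "'a::complex_normed_vector \<Rightarrow>\<^sub>C\<^sub>L 'a"
  assumes "finite B" "V \<subseteq> cspan B" "S ` V \<subseteq> V" "x \<in> V"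
  shows "\<exists>p. p \<noteq> 0 \<and> poly_act S p x = 0"
proof -
  define v where "v n = (cblinfun_apply S ^^ n) x" for n
  have "v n \<in> V" for n
    using assms(3,4) by (induction n) (auto simp: v_def)
  then obtain n where n: "v n \<in> cspan (v ` {..<n})"
    using in_span_of_previous[OF assms(1), of v] assms(2) by blast
  \<comment> \<open>The bound on the coefficients keeps \<open>p\<close> from cancelling
    \<open>monom 1 n\<close> below.\<close>
  have "\<exists>p. (\<forall>i\<ge>n. coeff p i = 0) \<and> y = poly_act S p x" if "y \<in> cspan (v ` {..<n})" for y
    using that
  proof (induction rule: complex_vector.span_induct_alt)
    case base
    show ?case by (rule exI[of _ 0]) simp
  next
    case (step c u w)
    then obtain i p where i: "i < n" "u = v i" and p: "\<forall>i\<ge>n. coeff p i = 0" "w = poly_act S p x"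
      by blast
    show ?case
      by (rule exI[of _ "smult c (monom 1 i) + p"])
        (use i p in \<open>simp add: poly_act_add poly_act_smult poly_act_monom v_def\<close>)
  qed
  from this[OF n] obtain p where p: "\<forall>i\<ge>n. coeff p i = 0" "v n = poly_act S p x" by blast
  let ?q = "monom 1 n + smult (- 1) p"
  have "coeff ?q n = 1" using p by simp
  then have "?q \<noteq> 0" by (metis coeff_0 zero_neq_one)
  moreover have "poly_act S ?q x = 0"
    unfolding poly_act_add poly_act_smult poly_act_monom using p(2)
    by (simp add: v_def complex_vector.scale_minus_left scaleC_one)
  ultimately show ?thesis by blast
qed

text \<open>Split a root \<open>c\<close> off an annihilating polynomial of least degree: the
  cofactor does not annihilate \<open>x\<close>, and it sends \<open>x\<close> to an eigenvector for
  \<open>c\<close>.\<close>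

lemma exists_eigenvector:
  fixes S :: "'a::complex_normed_vector \<Rightarrow>\<^sub>C\<^sub>L 'a"
  assumes B: "finite B" "V \<subseteq> cspan B" and V: "S ` V \<subseteq> V" and x: "x \<in> V" "x \<noteq> 0"
  shows "point_spectrum S \<noteq> {}"
proof -
  define Q where "Q p \<longleftrightarrow> p \<noteq> 0 \<and> poly_act S p x = 0" for p
  have "\<exists>p. Q p" unfolding Q_def using exists_annihilating_poly[OF B V x(1)] .
  then obtain p where p: "Q p" "\<And>q. Q q \<Longrightarrow> degree p \<le> degree q"
    using ex_has_least_nat[of Q _ degree] by blast
  have "degree p \<noteq> 0"
  proof
    assume "degree p = 0"
    then obtain a where "p = [:a:]" by (meson degree_eq_zeroE)
    then show False using p(1) x(2) by (auto simp: Q_def)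
  qed
  then obtain c where "poly p c = 0"
    using alg_closed_imp_poly_has_root[of p] by blast
  then have "[:- c, 1:] dvd p" by (simp add: poly_eq_0_iff_dvd)
  then obtain q where q: "p = [:- c, 1:] * q" by (rule dvdE)
  with p(1) have "q \<noteq> 0" unfolding Q_def by fastforce
  then have "degree p = Suc (degree q)" unfolding q by (subst degree_mult_eq) auto
  with p(2)[of q] \<open>q \<noteq> 0\<close> have nz: "poly_act S q x \<noteq> 0" by (auto simp: Q_def)
  \<comment> \<open>Multiplying \<open>q\<close> by the variable is \<open>pCons 0 q\<close>, which
    \<open>poly_act\<close> turns into one more application of \<open>S\<close>.\<close>
  have "p = smult (- c) q + pCons 0 q" unfolding q by simp
  with p(1) have "- c *\<^sub>C poly_act S q x + S (poly_act S q x) = 0"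
    by (simp only: Q_def poly_act_add poly_act_smult poly_act_pCons) simp
  then have "S (poly_act S q x) = c *\<^sub>C poly_act S q x"
    by (simp add: complex_vector.scale_minus_left)
  with nz show ?thesis unfolding point_spectrum_def by blast
qed

section \<open>Functionals and finite codimension\<close>

text \<open>Restriction to \<open>B\<close> is injective on \<open>W\<close>. Passing to the
  functionals that vanish at \<open>b\<close> costs at most one dimension: any \<open>k\<close> with
  \<open>k b \<noteq> 0\<close> spans the rest.\<close>

lemma finite_span_of_functionals:
  fixes W :: "('a::complex_normed_vector \<Rightarrow>\<^sub>C\<^sub>L complex) set"
  assumes "finite B" "csubspace W" "\<And>g. g \<in> W \<Longrightarrow> (\<forall>b\<in>B. g b = 0) \<Longrightarrow> g = 0"
  shows "\<exists>C. finite C \<and> W \<subseteq> cspan C"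
  using assms
proof (induction B arbitrary: W rule: finite_induct)
  case empty
  then show ?case by (intro exI[of _ "{}"]) auto
next
  case (insert b B)
  define W' where "W' = {g \<in> W. g b = 0}"
  have "csubspace W'"
    using insert.prems(1) unfolding W'_def
    by (auto simp: complex_vector.subspace_def scaleC_complex_def)
  moreover have "g = 0" if "g \<in> W'" "\<forall>b\<in>B. g b = 0" for g
    using that insert.prems(2) by (auto simp: W'_def)
  ultimately obtain C where C: "finite C" "W' \<subseteq> cspan C" using insert.IH by blast
  show ?case
  proof (cases "\<exists>g\<in>W. g b \<noteq> 0")
    case False
    then have "W = W'" by (auto simp: W'_def)
    with C show ?thesis by blast
  next
    case True
    then obtain k where k: "k \<in> W" "k b \<noteq> 0" by blast
    have "g \<in> cspan (insert k C)" if "g \<in> W" for g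
    proof -
      have "g - (g b / k b) *\<^sub>C k \<in> W'"
        using that k insert.prems(1) unfolding W'_def
        by (auto intro: complex_vector.subspace_diff complex_vector.subspace_scale
            simp: scaleC_complex_def)
      then show ?thesis using C(2) by (auto simp: complex_vector.span_insert)
    qed
    then show ?thesis using C(1) by (intro exI[of _ "insert k C"]) auto
  qed
qed

definition annihilator :: "'a::complex_normed_vector set \<Rightarrow> ('a \<Rightarrow>\<^sub>C\<^sub>L complex) set"
  where "annihilator Y = {g. \<forall>y\<in>Y. cblinfun_apply g y = 0}"

lemma csubspace_annihilator: "csubspace (annihilator Y)"
  by (auto simp: complex_vector.subspace_def annihilator_def scaleC_complex_def)

text \<open>A functional vanishing on \<open>Y\<close> is determined by its values on finitely many
  vectors that span modulo \<open>Y\<close>. Infinite codimension is thus detected by an infinite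
  dimensional annihilator.\<close>

lemma annihilator_of_finite_codim:
  assumes "cfinite_codim (Y :: 'a::complex_normed_vector set)"
  shows "\<exists>C. finite C \<and> annihilator Y \<subseteq> cspan C"
proof -
  from assms obtain B where B: "finite B" "\<And>x. \<exists>b\<in>cspan B. x - b \<in> Y"
    unfolding cfinite_codim_def by blast
  have "g = 0" if g: "g \<in> annihilator Y" "\<forall>b\<in>B. g b = 0" for g
  proof (rule cblinfun_eqI)
    fix x
    obtain b where b: "b \<in> cspan B" "x - b \<in> Y" using B(2) by blast
    have "cspan B \<subseteq> {y. g y \<in> {0}}"
      by (intro complex_vector.span_minimal csubspace_cblinfun_vimage) (use g(2) in auto)
    then have "g b = 0" "g (x - b) = 0" using b g(1) by (auto simp: annihilator_def)
    then show "g x = cblinfun_apply 0 x" by simp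
  qed
  then show ?thesis
    by (intro finite_span_of_functionals[OF B(1) csubspace_annihilator])
qed

text \<open>The functional is the coordinate with respect to a basis vector \<open>e\<close> of the
  range; uniqueness of coordinates makes it linear, and \<open>norm F / norm e\<close> bounds
  it.\<close>

lemma rank_one_decomposition:
  fixes F :: "'a::complex_normed_vector \<Rightarrow>\<^sub>C\<^sub>L 'b::complex_normed_vector"
  assumes "rank_one F"
  shows "\<exists>e \<phi>. e \<noteq> 0 \<and> \<phi> \<noteq> 0 \<and> (\<forall>x. F x = cblinfun_apply \<phi> x *\<^sub>C e)"
proof -
  obtain B where B: "B \<subseteq> range F" "\<not> cdependent B" "range F \<subseteq> cspan B" "card B = 1"
    using complex_vector.basis_exists[of "range F"] assms unfolding rank_one_def by metis
  then obtain e where e: "B = {e}" by (auto simp: card_1_singleton_iff)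
  have "e \<noteq> 0" using B(2) complex_vector.dependent_zero e by blast
  have "\<exists>c. F x = c *\<^sub>C e" for x
    using B(3) unfolding e complex_vector.span_singleton by blast
  then obtain c where c: "\<And>x. F x = c x *\<^sub>C e" by metis
  have eqI: "a = b" if "a *\<^sub>C e = b *\<^sub>C e" for a b
    using that \<open>e \<noteq> 0\<close> by simp
  have "bounded_clinear c"
  proof (intro bounded_clinearI bounded_linear_intro[where K = "norm F / norm e"])
    fix x y and r :: real and a
    show "c (x + y) = c x + c y"
      by (rule eqI) (simp add: c[symmetric] scaleC_add_left)
    show scale: "c (a *\<^sub>C x) = a *\<^sub>C c x" for a
      by (rule eqI) (simp add: c[symmetric] scaleC_complex_def scaleC_scaleC[symmetric])
    show "c (r *\<^sub>R x) = r *\<^sub>R c x"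
      unfolding scaleR_scaleC by (rule scale)
    have "norm (c x) * norm e = norm (F x)" by (simp add: c norm_scaleC)
    with norm_cblinfun_apply_le[of F x] show "norm (c x) \<le> norm x * (norm F / norm e)"
      using \<open>e \<noteq> 0\<close> by (simp add: field_simps)
  qed
  then have "cblinfun_apply (CBlinfun c) = c" by (simp add: CBlinfun_inverse)
  with c have F: "F x = cblinfun_apply (CBlinfun c) x *\<^sub>C e" for x by simp
  have "e \<in> range F" using B(1) e by blast
  then have "CBlinfun c \<noteq> 0" using F \<open>e \<noteq> 0\<close> by auto
  with F \<open>e \<noteq> 0\<close> show ?thesis by blast
qed


section \<open>Half-spaces\<close>

text \<open>Eigenvectors of \<open>S\<close> and of its adjoint for different eigenvalues pair to
  zero. So the span of the \<open>x\<close> of even index is annihilated by every \<open>y\<close>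
  of odd index, and each of these two families is linearly independent.\<close>

lemma invariant_half_space_from_eigenvectors:
  fixes S :: "'a::complex_normed_vector \<Rightarrow>\<^sub>C\<^sub>L 'a"
  assumes x: "\<And>i::nat. x i \<noteq> 0" "\<And>i. S (x i) = \<mu> i *\<^sub>C x i"
    and y: "\<And>i. y i \<noteq> 0" "\<And>i. cadjoint S (y i) = \<mu> i *\<^sub>C y i"
    and inj: "inj \<mu>"
  shows "has_invariant_half_space S"
proof -
  define Y where "Y = closure (cspan (range (\<lambda>i. x (2 * i))))"
  have ortho: "cblinfun_apply (y j) (x i) = 0" if "i \<noteq> j" for i j
  proof -
    have "\<mu> i * y j (x i) = y j (S (x i))" by (simp add: x(2) scaleC_complex_def)
    also have "\<dots> = cadjoint S (y j) (x i)" by simp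
    also have "\<dots> = \<mu> j * y j (x i)" unfolding y(2) by (simp add: scaleC_complex_def)
    finally have "\<mu> i = \<mu> j \<or> y j (x i) = 0" by auto
    then show ?thesis using that inj by (simp add: inj_eq)
  qed
  have sub: "range (\<lambda>i. x (2 * i)) \<subseteq> Y"
    unfolding Y_def
    using closure_subset complex_vector.span_superset by (rule order_trans[rotated])
  have ann: "range (\<lambda>i. y (2 * i + 1)) \<subseteq> annihilator Y"
  proof -
    have "y (2 * j + 1) w = 0" if "w \<in> Y" for j w
    proof (rule cblinfun_vanishes_on_closure_cspan)
      show "w \<in> closure (cspan (range (\<lambda>i. x (2 * i))))" using that unfolding Y_def .
      have "y (2 * j + 1) (x (2 * i)) = 0" for i by (rule ortho) presburger
      then show "y (2 * j + 1) u = 0" if "u \<in> range (\<lambda>i. x (2 * i))" for u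
        using that by blast
    qed
    then show ?thesis unfolding annihilator_def by blast
  qed
  have inj2: "inj (\<lambda>i. \<mu> (2 * i))" "inj (\<lambda>i. \<mu> (2 * i + 1))"
    by (rule injI, simp add: inj_eq[OF inj])+
  have "\<not> cfinite_dim Y"
  proof
    assume "cfinite_dim Y"
    then obtain B where B: "finite B" "Y = cspan B" unfolding cfinite_dim_def by blast
    have "\<not> range (\<lambda>i. x (2 * i)) \<subseteq> cspan B"
      by (rule eigenvectors_not_in_finite_span[OF x(1) x(2) inj2(1) B(1)])
    then show False using sub B(2) by blast
  qed
  moreover have "\<not> cfinite_codim Y"
  proof
    assume "cfinite_codim Y"
    then obtain C where C: "finite C" "annihilator Y \<subseteq> cspan C"
      using annihilator_of_finite_codim by blast
    have "\<not> range (\<lambda>i. y (2 * i + 1)) \<subseteq> cspan C"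
      by (rule eigenvectors_not_in_finite_span[OF y(1) y(2) inj2(2) C(1)])
    then show False using ann C(2) by blast
  qed
  moreover have "closed Y" "csubspace Y"
    unfolding Y_def by (simp_all add: csubspace_closure)
  moreover have "S ` Y \<subseteq> Y"
    unfolding Y_def
  proof (rule cblinfun_closure_cspan_subset)
    have "S (x (2 * i)) \<in> Y" for i
      unfolding x(2) using sub \<open>csubspace Y\<close> by (intro complex_vector.subspace_scale) auto
    then show "S ` range (\<lambda>i. x (2 * i)) \<subseteq> closure (cspan (range (\<lambda>i. x (2 * i))))"
      unfolding Y_def by blast
  qed
  ultimately show ?thesis
    unfolding has_invariant_half_space_def half_space_def by blast
qed

text \<open>In finite dimension \<open>Y\<close> would contain an eigenvector of \<open>T\<close>;
  in finite codimension its annihilator would contain one of \<open>cadjoint T\<close>. The elements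
  \<open>y\<close> and \<open>\<phi>\<close> make both spaces non-zero.\<close>

lemma half_space_of_no_point_spectrum:
  fixes T :: "'a::complex_normed_vector \<Rightarrow>\<^sub>C\<^sub>L 'a"
  assumes T: "point_spectrum T = {}" "point_spectrum (cadjoint T) = {}"
    and Y: "closed Y" "csubspace Y" "T ` Y \<subseteq> Y"
    and y: "y \<in> Y" "y \<noteq> 0" and \<phi>: "\<phi> \<in> annihilator Y" "\<phi> \<noteq> 0"
  shows "half_space Y"
proof -
  have "\<not> cfinite_dim Y"
  proof
    assume "cfinite_dim Y"
    then obtain B where B: "finite B" "Y = cspan B" unfolding cfinite_dim_def by blast
    from exists_eigenvector[OF B(1) _ Y(3) y] T(1) show False unfolding B(2) by auto
  qed
  moreover have "\<not> cfinite_codim Y"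
  proof
    assume "cfinite_codim Y"
    then obtain C where C: "finite C" "annihilator Y \<subseteq> cspan C"
      using annihilator_of_finite_codim by blast
    have "cadjoint T ` annihilator Y \<subseteq> annihilator Y"
      using Y(3) by (auto simp: annihilator_def)
    from exists_eigenvector[OF C this \<phi>] T(2) show False by blast
  qed
  ultimately show ?thesis using Y unfolding half_space_def by blast
qed


section \<open>The resolvent of a quasinilpotent operator\<close>

text \<open>\<open>R z\<close> is the inverse of \<open>1 - z T\<close>, so \<open>z = 0\<close> is not singular and \<open>R\<close> is entire.\<close>

locale entire_resolvent =
  fixes T :: "'a::complex_normed_vector \<Rightarrow>\<^sub>C\<^sub>L 'a" and R :: "complex \<Rightarrow> 'a \<Rightarrow>\<^sub>C\<^sub>L 'a"
  assumes left_inverse: "cblinfun_apply (R z) (x - z *\<^sub>C T x) = x"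
    and right_inverse: "cblinfun_apply (R z) x - z *\<^sub>C T (R z x) = x"

text \<open>For \<open>z \<noteq> 0\<close> and \<open>c = 1/z\<close>, the operator
  \<open>1 - z T\<close> is \<open>- z\<close> times the invertible \<open>T - c\<close>, so its
  inverse is \<open>- c\<close> times that of \<open>T - c\<close>.\<close>

lemma quasinilpotent_entire_resolvent:
  fixes T :: "'a::complex_normed_vector \<Rightarrow>\<^sub>C\<^sub>L 'a"
  assumes "quasinilpotent T"
  shows "\<exists>R. entire_resolvent T R"
proof -
  have "\<exists>Q. (\<forall>x. cblinfun_apply Q (x - z *\<^sub>C T x) = x) \<and> (\<forall>x. Q x - z *\<^sub>C T (Q x) = x)" for z
  proof (cases "z = 0")
    case True
    then show ?thesis by (intro exI[of _ id_cblinfun]) simp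
  next
    case False
    define c where "c = 1 / z"
    have cz: "c * z = 1" "z * c = 1" using False by (simp_all add: c_def)
    have "c \<notin> spectrum T" using assms False by (simp add: quasinilpotent_def c_def)
    then obtain S where "S o\<^sub>C\<^sub>L (T - c *\<^sub>C id_cblinfun) = id_cblinfun"
        "(T - c *\<^sub>C id_cblinfun) o\<^sub>C\<^sub>L S = id_cblinfun"
      unfolding spectrum_def by blast
    from this[THEN arg_cong[where f = cblinfun_apply], THEN fun_cong]
    have S: "S (T x) - c *\<^sub>C S x = x" "T (S x) - c *\<^sub>C S x = x" for x
      by simp_all
    show ?thesis
    proof (intro exI conjI allI)
      fix x
      show "cblinfun_apply ((- c) *\<^sub>C S) (x - z *\<^sub>C T x) = x"
        using S(1)[of x] cz
        by (simp add: complex_vector.scale_right_diff_distrib scaleC_scaleC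
            complex_vector.scale_minus_left scaleC_one)
      show "cblinfun_apply ((- c) *\<^sub>C S) x - z *\<^sub>C T (cblinfun_apply ((- c) *\<^sub>C S) x) = x"
        using S(2)[of x] cz
        by (simp add: complex_vector.scale_right_diff_distrib scaleC_scaleC
            complex_vector.scale_minus_left scaleC_one)
    qed
  qed
  then show ?thesis unfolding entire_resolvent_def by metis
qed

context entire_resolvent
begin

lemma resolvent_0 [simp]: "cblinfun_apply (R 0) x = x"
  using left_inverse[of 0 x] by simp

text \<open>With \<open>y = R z x\<close>, split \<open>x\<close> as
  \<open>(y - w T y) + (w - z) T y\<close> and apply \<open>R w\<close>.\<close>

lemma resolvent_identity: "R w x - R z x = (w - z) *\<^sub>C R w (T (R z x))"
proof -
  let ?y = "R z x"
  have "x = (?y - w *\<^sub>C T ?y) + (w - z) *\<^sub>C T ?y"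
    using right_inverse[of z x] by (simp add: complex_vector.scale_left_diff_distrib)
  then have "R w x = R w ((?y - w *\<^sub>C T ?y) + (w - z) *\<^sub>C T ?y)" by (rule arg_cong)
  also have "\<dots> = ?y + (w - z) *\<^sub>C R w (T ?y)"
    unfolding cblinfun_apply_add left_inverse by simp
  finally show ?thesis by simp
qed

lemma resolvent_shift: "R z x = x + z *\<^sub>C R z (T x)"
  using left_inverse[of z x] by (simp add: algebra_simps)

text \<open>The resolvent identity bounds \<open>norm (R w)\<close> by
  \<open>norm (R z) + norm (R w) / 2\<close>, and the last term is absorbed on the left. This local
  bound yields continuity.\<close>

lemma norm_resolvent_le:
  assumes "cmod (w - z) * (norm T * norm (R z)) \<le> 1 / 2"
  shows "norm (R w) \<le> 2 * norm (R z)"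
proof -
  have "R w = R z + (w - z) *\<^sub>C (R w o\<^sub>C\<^sub>L (T o\<^sub>C\<^sub>L R z))"
    by (rule cblinfun_eqI) (simp add: resolvent_identity[of w _ z, symmetric])
  from arg_cong[OF this, of norm] have "norm (R w) \<le> norm (R z) + norm ((w - z) *\<^sub>C (R w o\<^sub>C\<^sub>L (T o\<^sub>C\<^sub>L R z)))"
    using norm_triangle_ineq[of "R z"] by simp
  also have "norm ((w - z) *\<^sub>C (R w o\<^sub>C\<^sub>L (T o\<^sub>C\<^sub>L R z)))
      \<le> cmod (w - z) * (norm (R w) * (norm T * norm (R z)))"
    unfolding norm_scaleC
    by (intro mult_left_mono order_trans[OF norm_cblinfun_compose_le] norm_cblinfun_compose_le) auto
  also have "\<dots> = norm (R w) * (cmod (w - z) * (norm T * norm (R z)))" by simp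
  also have "\<dots> \<le> norm (R w) * (1 / 2)"
    using assms by (rule mult_left_mono) simp
  finally show ?thesis by simp
qed

lemma isCont_resolvent: "isCont (\<lambda>w. R w x) z"
proof -
  have lim: "((\<lambda>w. cmod (w - z) * K) \<longlongrightarrow> 0) (at z)" for K
    by (intro tendsto_mult_left_zero tendsto_norm_zero LIM_zero tendsto_ident_at)
  then have ev: "\<forall>\<^sub>F w in at z. cmod (w - z) * (norm T * norm (R z)) < 1 / 2"
    by (rule order_tendstoD(2)[OF _ half_gt_zero[OF zero_less_one]])
  let ?K = "2 * norm (R z) * norm (T (R z x))"
  have "\<forall>\<^sub>F w in at z. norm (R w x - R z x) \<le> cmod (w - z) * ?K"
    using ev
  proof eventually_elim
    case (elim w)
    have "norm (R w x - R z x) \<le> cmod (w - z) * (norm (R w) * norm (T (R z x)))"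
      unfolding resolvent_identity norm_scaleC
      by (intro mult_left_mono norm_cblinfun_apply_le) simp
    also have "\<dots> \<le> cmod (w - z) * ?K"
      using norm_resolvent_le[OF less_imp_le[OF elim]]
      by (intro mult_left_mono mult_right_mono norm_ge_zero)
    finally show ?case .
  qed
  then have "((\<lambda>w. R w x - R z x) \<longlongrightarrow> 0) (at z)"
    using lim by (rule Lim_null_comparison)
  then show ?thesis unfolding isCont_def by (rule LIM_zero_cancel)
qed

text \<open>The resolvent identity exhibits the difference quotient as a function of
  \<open>w\<close> that is continuous at \<open>z\<close>, which is Caratheodory's form of
  differentiability.\<close>

lemma holomorphic_resolvent:
  fixes \<phi> :: "'a \<Rightarrow>\<^sub>C\<^sub>L complex"
  shows "(\<lambda>z. \<phi> (R z x)) holomorphic_on A"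
proof (rule holomorphic_onI)
  fix z
  let ?g = "\<lambda>w. \<phi> (R w (T (R z x)))"
  have diff: "\<phi> (R w x) - \<phi> (R z x) = ?g w * (w - z)" for w
  proof -
    have "\<phi> (R w x) - \<phi> (R z x) = \<phi> (R w x - R z x)"
      by (rule cblinfun_apply_diff[symmetric])
    also have "\<dots> = (w - z) * ?g w"
      unfolding resolvent_identity cblinfun_apply_scaleC scaleC_complex_def ..
    finally show ?thesis by (simp only: mult.commute)
  qed
  have cont: "isCont ?g z"
    by (rule bounded_linear.isCont[OF cblinfun_apply_bounded_linear[of \<phi>] isCont_resolvent])
  have "((\<lambda>z. \<phi> (R z x)) has_field_derivative ?g z) (at z)"
    unfolding CARAT_DERIV
  proof (rule exI[of _ ?g], safe)
    show "\<phi> (R w x) - \<phi> (R z x) = ?g w * (w - z)" for w by (rule diff)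
    show "isCont ?g z" by (rule cont)
  qed
  from has_field_derivative_at_within[OF this]
  show "(\<lambda>z. \<phi> (R z x)) field_differentiable (at z within A)"
    unfolding field_differentiable_def by (rule exI)
qed

text \<open>A finite Neumann expansion, obtained by iterating \<open>resolvent_shift\<close>; its
  remainder is exact and again involves the resolvent.\<close>

lemma resolvent_expansion:
  fixes \<phi> :: "'a \<Rightarrow>\<^sub>C\<^sub>L complex"
  shows "\<phi> (R z x) =
    (\<Sum>k<n. z ^ k * \<phi> ((cblinfun_apply T ^^ k) x)) + z ^ n * \<phi> (R z ((cblinfun_apply T ^^ n) x))"
proof (induction n)
  case (Suc n)
  let ?y = "(cblinfun_apply T ^^ n) x"
  have "\<phi> (R z ?y) = \<phi> ?y + z * \<phi> (R z (T ?y))"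
    by (subst resolvent_shift) (simp add: scaleC_complex_def)
  with Suc show ?case by (simp add: algebra_simps)
qed simp

lemma moments_vanish_of_polynomial:
  fixes \<phi> :: "'a \<Rightarrow>\<^sub>C\<^sub>L complex"
  assumes poly: "\<And>z. z * \<phi> (R z x) = (\<Sum>i\<le>n. a i * z ^ i)" and "n \<le> m"
  shows "\<phi> ((cblinfun_apply T ^^ m) x) = 0"
proof -
  \<comment> \<open>\<open>z\<^sup>m\<^sup>+\<^sup>1 g(z)\<close> is a polynomial of degree at most \<open>m\<close>, so the entire function \<open>g\<close> tends to \<open>0\<close> at infinity.\<close>
  define g where "g z = \<phi> (R z ((cblinfun_apply T ^^ m) x))" for z
  let ?c = "\<lambda>k. \<phi> ((cblinfun_apply T ^^ k) x)"
  have lim: "((\<lambda>z::complex. z ^ i / z ^ Suc m) \<longlongrightarrow> 0) at_infinity" if "i < Suc m" for i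
  proof (rule Lim_transform_eventually)
    show "((\<lambda>z::complex. inverse (z ^ (Suc m - i))) \<longlongrightarrow> 0) at_infinity"
      using that
      by (intro filterlim_compose[OF tendsto_inverse_0] filterlim_power_at_infinity filterlim_ident) simp
    show "\<forall>\<^sub>F z::complex in at_infinity. inverse (z ^ (Suc m - i)) = z ^ i / z ^ Suc m"
      using eventually_not_equal_at_infinity[of "0::complex"]
    proof eventually_elim
      case (elim z)
      have "z ^ Suc m = z ^ i * z ^ (Suc m - i)" using that by (simp flip: power_add)
      then show ?case using elim by (simp add: field_simps)
    qed
  qed
  \<comment> \<open>The expansion is solved for its remainder. The factor \<open>z\<close> in the
    assumed polynomial raises the exponent to \<open>Suc m\<close>, which exceeds every
    \<open>i \<le> n\<close> and every \<open>Suc k \<le> m\<close>.\<close>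
  have "g z = (\<Sum>i\<le>n. a i * (z ^ i / z ^ Suc m)) - (\<Sum>k<m. ?c k * (z ^ Suc k / z ^ Suc m))"
    if "z \<noteq> 0" for z
  proof -
    have "z ^ Suc m * g z = z * \<phi> (R z x) - (\<Sum>k<m. ?c k * z ^ Suc k)"
      unfolding resolvent_expansion[of \<phi> z x m] g_def
      by (simp add: algebra_simps sum_distrib_left)
    then have "g z = ((\<Sum>i\<le>n. a i * z ^ i) - (\<Sum>k<m. ?c k * z ^ Suc k)) / z ^ Suc m"
      using that unfolding poly by (simp add: field_simps)
    then show ?thesis
      unfolding diff_divide_distrib sum_divide_distrib times_divide_eq_right .
  qed
  then have "\<forall>\<^sub>F z in at_infinity.
      (\<Sum>i\<le>n. a i * (z ^ i / z ^ Suc m)) - (\<Sum>k<m. ?c k * (z ^ Suc k / z ^ Suc m)) = g z"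
    using eventually_not_equal_at_infinity[of "0::complex"] by (auto elim: eventually_mono)
  moreover have "((\<lambda>z. (\<Sum>i\<le>n. a i * (z ^ i / z ^ Suc m)) - (\<Sum>k<m. ?c k * (z ^ Suc k / z ^ Suc m)))
      \<longlongrightarrow> (\<Sum>i\<le>n. a i * 0) - (\<Sum>k<m. ?c k * 0)) at_infinity"
    using \<open>n \<le> m\<close> by (intro tendsto_intros lim) auto
  ultimately have "(g \<longlongrightarrow> 0) at_infinity"
    by (auto intro: Lim_transform_eventually)
  \<comment> \<open>By Liouville's theorem \<open>g\<close> vanishes identically, and its value at 0
    is the moment since \<open>R 0\<close> is the identity.\<close>
  then have "g 0 = 0"
    using holomorphic_resolvent[of \<phi> _ UNIV] unfolding g_def by (intro Liouville_weak_0)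
  then show ?thesis by (simp add: g_def)
qed

text \<open>The substitution \<open>u = 1/z\<close> moves infinity to 0, where Picard's great
  theorem applies; \<open>u\<close> later becomes the eigenvalue.\<close>

lemma moments_vanish_or_values_infinitely_often:
  fixes \<phi> :: "'a \<Rightarrow>\<^sub>C\<^sub>L complex"
  shows "(\<exists>N. \<forall>n\<ge>N. \<phi> ((cblinfun_apply T ^^ n) x) = 0) \<or>
    (\<exists>a. \<forall>c. c \<noteq> a \<longrightarrow> infinite {u. u \<noteq> 0 \<and> inverse u * \<phi> (R (inverse u) x) = c})"
proof (rule disjCI)
  assume "\<nexists>a. \<forall>c. c \<noteq> a \<longrightarrow> infinite {u. u \<noteq> 0 \<and> inverse u * \<phi> (R (inverse u) x) = c}"
  then have no_a: "\<not> (\<forall>c. c \<noteq> a \<longrightarrow> infinite {u. u \<noteq> 0 \<and> inverse u * \<phi> (R (inverse u) x) = c})" for a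
    by blast
  define h where "h z = z * \<phi> (R z x)" for z
  have hol: "h holomorphic_on A" for A
    unfolding h_def by (intro holomorphic_intros holomorphic_resolvent)
  have hol_inv: "(\<lambda>u. h (inverse u)) holomorphic_on UNIV - {0}"
    by (rule holomorphic_on_compose[of inverse _ h, unfolded o_def, OF _ hol])
      (auto intro: holomorphic_on_inverse holomorphic_on_ident)
  \<comment> \<open>If neither limit existed, 0 would be an essential singularity, and Picard's
    theorem would contradict \<open>no_a\<close>.\<close>
  have "\<exists>l. ((\<lambda>u. h (inverse u)) \<longlongrightarrow> l) (at 0) \<or>
      ((inverse \<circ> (\<lambda>u. h (inverse u))) \<longlongrightarrow> l) (at 0)"
  proof (rule ccontr)
    assume no_lim: "\<not> ?thesis"
    obtain a where "\<And>c. c \<noteq> a \<Longrightarrow> infinite {u. u \<in> UNIV - {0} \<and> h (inverse u) = c}"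
    proof (rule great_Picard_infinite[OF open_UNIV UNIV_I hol_inv])
      show "\<not> ((\<lambda>u. h (inverse u)) \<longlongrightarrow> l) (at 0)" for l using no_lim by blast
      show "\<not> ((inverse \<circ> (\<lambda>u. h (inverse u))) \<longlongrightarrow> l) (at 0)" for l using no_lim by blast
    qed blast
    then show False using no_a[of a] by (simp add: h_def)
  qed
  then obtain l where "(h \<longlongrightarrow> l) at_infinity \<or> ((inverse \<circ> h) \<longlongrightarrow> l) at_infinity"
    unfolding lim_at_infinity_0 o_def by blast
  \<comment> \<open>A limit of \<open>h\<close> makes it constant by Liouville's theorem; a limit of
    \<open>1/h\<close> makes it a polynomial.\<close>
  then obtain a n where "\<And>z. h z = (\<Sum>i\<le>n. a i * z ^ i)"
  proof
    assume "(h \<longlongrightarrow> l) at_infinity"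
    then have "h z = (\<Sum>i\<le>0. l * z ^ i)" for z
      using Liouville_weak[OF hol, of l] by simp
    then show ?thesis by (rule that)
  next
    assume "((inverse \<circ> h) \<longlongrightarrow> l) at_infinity"
    then show ?thesis by (rule pole_at_infinity[OF hol]) (rule that)
  qed
  then show "\<exists>N. \<forall>n\<ge>N. \<phi> ((cblinfun_apply T ^^ n) x) = 0"
    unfolding h_def using moments_vanish_of_polynomial[of \<phi> x a n] by blast
qed

end


section \<open>Rank one perturbations\<close>

text \<open>On the closed span of the tail of the orbit \<open>F\<close> vanishes, so
  \<open>T + \<alpha> F\<close> acts there as \<open>T\<close>, whatever \<alpha> is.\<close>

lemma invariant_half_space_of_vanishing_moments:
  fixes T F :: "'a::complex_normed_vector \<Rightarrow>\<^sub>C\<^sub>L 'a"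
  assumes T: "point_spectrum T = {}" "point_spectrum (cadjoint T) = {}"
    and F: "\<And>x. F x = cblinfun_apply \<phi> x *\<^sub>C e" and "e \<noteq> 0" "\<phi> \<noteq> 0"
    and moments: "\<forall>n\<ge>N. cblinfun_apply \<phi> ((cblinfun_apply T ^^ n) e) = 0"
  shows "has_invariant_half_space (T + \<alpha> *\<^sub>C F)"
proof -
  let ?A = "(\<lambda>n. (cblinfun_apply T ^^ n) e) ` {N..}"
  define Y where "Y = closure (cspan ?A)"
  have A: "?A \<subseteq> Y"
    unfolding Y_def
    using closure_subset complex_vector.span_superset by (rule order_trans[rotated])
  have \<phi>: "\<phi> y = 0" if "y \<in> Y" for y
    using that unfolding Y_def
    by (rule cblinfun_vanishes_on_closure_cspan[rotated]) (use moments in blast)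
  have "T ` ?A \<subseteq> Y"
  proof
    fix w assume "w \<in> T ` ?A"
    then obtain n where n: "n \<ge> N" "w = (cblinfun_apply T ^^ Suc n) e" by auto
    then show "w \<in> Y" using A by (metis (mono_tags, lifting) atLeast_iff image_subset_iff le_Suc_eq)
  qed
  then have TY: "T ` Y \<subseteq> Y"
    unfolding Y_def by (rule cblinfun_closure_cspan_subset)
  \<comment> \<open>As 0 is not an eigenvalue of \<open>T\<close>, the orbit of \<open>e\<close>
    never reaches 0, and \<open>Y\<close> is non-zero.\<close>
  have "(cblinfun_apply T ^^ n) e \<noteq> 0" for n
  proof (induction n)
    case 0
    show ?case using \<open>e \<noteq> 0\<close> by simp
  next
    case (Suc n)
    have "\<not> T ((cblinfun_apply T ^^ n) e) = 0 *\<^sub>C (cblinfun_apply T ^^ n) e"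
      using T(1) Suc unfolding point_spectrum_def by blast
    then show ?case by simp
  qed
  moreover have "(cblinfun_apply T ^^ N) e \<in> Y" using A by blast
  moreover have "closed Y" "csubspace Y"
    unfolding Y_def by (simp_all add: csubspace_closure)
  moreover have "\<phi> \<in> annihilator Y"
    unfolding annihilator_def using \<phi> by blast
  ultimately have "half_space Y"
    using half_space_of_no_point_spectrum[OF T _ _ TY _ _ _ \<open>\<phi> \<noteq> 0\<close>] by blast
  moreover have "(T + \<alpha> *\<^sub>C F) ` Y \<subseteq> Y"
  proof
    fix w assume "w \<in> (T + \<alpha> *\<^sub>C F) ` Y"
    then obtain y where y: "y \<in> Y" "w = (T + \<alpha> *\<^sub>C F) y" by blast
    then have "w = T y" by (simp add: F \<phi> scaleC_zero)
    then show "w \<in> Y" using y(1) TY by blast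
  qed
  ultimately show ?thesis unfolding has_invariant_half_space_def by blast
qed

text \<open>For \<open>x = R(1/u) e\<close> the equation says \<open>\<alpha> \<phi>(x) = u\<close>,
  so \<open>\<alpha> F x = u e\<close> compensates the defect in \<open>T x = u x - u e\<close>. The
  same number is what the functional \<open>\<phi> o R(1/u)\<close> needs to be an eigenvector of
  the adjoint.\<close>

lemma (in entire_resolvent) invariant_half_space_of_infinitely_many_solutions:
  assumes F: "\<And>x. cblinfun_apply F x = cblinfun_apply \<phi> x *\<^sub>C e" and "\<alpha> \<noteq> 0"
    and inf: "infinite {u. u \<noteq> 0 \<and> inverse u * cblinfun_apply \<phi> (R (inverse u) e) = inverse \<alpha>}"
  shows "has_invariant_half_space (T + \<alpha> *\<^sub>C F)"
proof -
  obtain \<mu> :: "nat \<Rightarrow> complex" where "inj \<mu>" and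
    \<mu>_in: "range \<mu> \<subseteq> {u. u \<noteq> 0 \<and> inverse u * cblinfun_apply \<phi> (R (inverse u) e) = inverse \<alpha>}"
    using infinite_countable_subset[OF inf] by blast
  from \<mu>_in have \<mu>: "\<mu> i \<noteq> 0" "inverse (\<mu> i) * \<phi> (R (inverse (\<mu> i)) e) = inverse \<alpha>" for i
    by blast+
  define x where "x i = R (inverse (\<mu> i)) e" for i
  define y where "y i = \<phi> o\<^sub>C\<^sub>L R (inverse (\<mu> i))" for i
  have \<phi>x: "\<alpha> * \<phi> (x i) = \<mu> i" for i
    using \<mu>(1)[of i] \<mu>(2)[of i] \<open>\<alpha> \<noteq> 0\<close> unfolding x_def by (simp add: field_simps)
  have nz: "\<phi> (x i) \<noteq> 0" for i
    using \<phi>x[of i] \<mu>(1)[of i] by auto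
  show ?thesis
  proof (rule invariant_half_space_from_eigenvectors)
    fix i
    let ?z = "inverse (\<mu> i)"
    show "x i \<noteq> 0" using nz[of i] by auto
    have "y i e = \<phi> (x i)" unfolding y_def x_def by simp
    then show "y i \<noteq> 0" using nz[of i] by auto
    have "\<mu> i *\<^sub>C e = \<mu> i *\<^sub>C (x i - ?z *\<^sub>C T (x i))"
      unfolding x_def right_inverse ..
    also have "\<dots> = \<mu> i *\<^sub>C x i - T (x i)"
      using \<mu>(1)[of i] by (simp add: complex_vector.scale_right_diff_distrib scaleC_scaleC scaleC_one)
    finally have "T (x i) + \<mu> i *\<^sub>C e = \<mu> i *\<^sub>C x i" by simp
    then show "(T + \<alpha> *\<^sub>C F) (x i) = \<mu> i *\<^sub>C x i"
      by (simp add: F scaleC_scaleC \<phi>x)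
    show "cadjoint (T + \<alpha> *\<^sub>C F) (y i) = \<mu> i *\<^sub>C y i"
    proof (rule cblinfun_eqI)
      fix w
      have "cadjoint (T + \<alpha> *\<^sub>C F) (y i) w = y i (T w) + \<alpha> * (\<phi> w * \<phi> (x i))"
        by (simp add: F y_def x_def scaleC_complex_def)
      also have "\<dots> = \<mu> i * (\<phi> w + ?z * y i (T w))"
        using \<mu>(1)[of i] by (simp add: \<phi>x[symmetric] algebra_simps)
      \<comment> \<open>One Neumann step, expanding the resolvent on the right-hand side
        only.\<close>
      also have "\<phi> w + ?z * y i (T w) = y i w"
        unfolding y_def cblinfun_compose_apply
        by (subst (2) resolvent_shift) (simp add: scaleC_complex_def)
      finally show "cadjoint (T + \<alpha> *\<^sub>C F) (y i) w = (\<mu> i *\<^sub>C y i) w"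
        by (simp add: scaleC_complex_def)
    qed
  qed (fact \<open>inj \<mu>\<close>)
qed

theorem theorem3p3:
  fixes T F :: "'a::complex_banach \<Rightarrow>\<^sub>C\<^sub>L 'a"
  assumes "separable_space (euclidean :: 'a topology)"
    and "quasinilpotent T"
    and "point_spectrum T = {}"
    and "point_spectrum (cadjoint T) = {}"
    and "rank_one F"
  shows "\<exists>E :: complex set. finite E \<and> card E \<le> 2 \<and>
           (\<forall>\<alpha>. \<alpha> \<noteq> 0 \<longrightarrow> \<alpha> \<notin> E \<longrightarrow> has_invariant_half_space (T + \<alpha> *\<^sub>C F))"
proof -
  obtain R where R: "entire_resolvent T R"
    using quasinilpotent_entire_resolvent[OF assms(2)] by blast
  obtain e \<phi> where e: "e \<noteq> 0" and \<phi>: "\<phi> \<noteq> 0"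
    and F: "\<And>x. F x = cblinfun_apply \<phi> x *\<^sub>C e"
    using rank_one_decomposition[OF assms(5)] by blast
  from entire_resolvent.moments_vanish_or_values_infinitely_often[OF R, of \<phi> e]
  show ?thesis
  proof (elim disjE exE)
    fix N assume "\<forall>n\<ge>N. cblinfun_apply \<phi> ((cblinfun_apply T ^^ n) e) = 0"
    then have "has_invariant_half_space (T + \<alpha> *\<^sub>C F)" for \<alpha>
      using invariant_half_space_of_vanishing_moments[OF assms(3,4) F e \<phi>] by blast
    then show ?thesis by (intro exI[of _ "{}"]) simp
  next
    fix a
    assume a: "\<forall>c. c \<noteq> a \<longrightarrow> infinite {u. u \<noteq> 0 \<and> inverse u * cblinfun_apply \<phi> (R (inverse u) e) = c}"
    have "has_invariant_half_space (T + \<alpha> *\<^sub>C F)" if "\<alpha> \<noteq> 0" "\<alpha> \<noteq> inverse a" for \<alpha>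
    proof (rule entire_resolvent.invariant_half_space_of_infinitely_many_solutions[OF R F that(1)])
      have "inverse \<alpha> \<noteq> a" using that(2) by auto
      with a show "infinite {u. u \<noteq> 0 \<and> inverse u * cblinfun_apply \<phi> (R (inverse u) e) = inverse \<alpha>}"
        by blast
    qed
    \<comment> \<open>For \<open>a = 0\<close> the convention \<open>inverse 0 = 0\<close> makes
      this the value already excluded by \<open>\<alpha> \<noteq> 0\<close>.\<close>
    then show ?thesis by (intro exI[of _ "{inverse a}"]) simp
  qed
qed

end
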